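(* Let $(X,r)$ be a right-non-degenerate (RND) solution, and let $k$ be a reflection for $(X,r)$. Then: 1. $r^{(k)}$ is an RND solution, i.e. it satisfies the Yang–Baxter equation and is right-non-degenerate. 2. $r$ and $r^{(k)}$ induce isomorphic braid monoid/group actions: for every $n$, the action of the positive braid monoid $B_n^+$ on $X^n$ induced by $r$ is isomorphic to the one induced by $r^{(k)}$ (there is a $B_n^+$-equivariant bijection $X^n\to X^n$); and the same holds for the actions of the braid group $B_n$ when $r$ is invertible. 3. For all integers $s>t\ge 0$, the relation $r^s=r^t$ is equivalent to $(r^{(k)})^s=(r^{(k)})^t$; in particular, $r$ is involutive (respectively idempotent) if and only if $r^{(k)}$ is so. 4. $r$ is invertible if and only if $r^{(k)}$ is invertible.
   Context: Products of maps denote composition, the rightmost map being applied first. For a map $\phi\colon X^m\to X^m$, $\phi_i$ denotes the map on $X^n$ that applies $\phi$ to the $m$ consecutive coordinates starting at position $i$ and is the identity on the others. A solution $(X,r)$ is a set $X$ with a map $r\colon X\times X\to X\times X$ (not assumed bijective) satisfying the Yang–Baxter equation $r_1r_2r_1=r_2r_1r_2$ on $X^3$; write $r(a,b)=(\lambda_a(b),\rho_b(a))$. It is right-non-degenerate (RND) if all maps $\rho_b\colon X\to X$ are bijective. A reflection for $(X,r)$ is a map $k\colon X\to X$ with $r k_2 r k_2=k_2 r k_2 r$ on $X^2$. Invertible means bijective, involutive means $r^2=\mathrm{Id}$, idempotent means $r^2=r$. For an RND solution and a reflection $k$, the $k$-derived solution is the map $r^{(k)}\colon X\times X\to X\times X$,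 $r^{(k)}(a,b)=(b',a')$, where $a'=\rho_b\rho_{k(b)}^{-1}(a)$ and $b'=\rho_{k(a')}\lambda_{\rho_{k(b)}^{-1}(a)}(b)$. A solution $r$ induces an action of the positive braid monoid $B_n^+$ on $X^n$ by letting the standard generator $\sigma_i$ act by $r_i$ ($1\le i<n$); if $r$ is invertible, this extends to an action of the braid group $B_n$. *)

theory Defs
  imports "HOL-Algebra.Group_Action"
begin

text \<open>
  A set \<open>X\<close> is the universe of a type \<open>'x\<close>, and \<open>X\<^sup>n\<close> is the set of lists of length \<open>n\<close>.
\<close>

definition tuples :: "nat \<Rightarrow> 'x list set" where
  "tuples n = {xs. length xs = n}"

text \<open>
  \<open>at_pos r i\<close> is the map \<open>r\<^sub>i\<close> on \<open>X\<^sup>n\<close>. Positions are counted from 1 as in the mathematical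
  notation, whereas list indices start from 0; it is only used for \<open>1 \<le> i < n\<close>.
\<close>

definition at_pos :: "('x \<times> 'x \<Rightarrow> 'x \<times> 'x) \<Rightarrow> nat \<Rightarrow> 'x list \<Rightarrow> 'x list" where
  "at_pos r i xs = (case r (xs ! (i - 1), xs ! i) of (a, b) \<Rightarrow> xs[i - 1 := a, i := b])"

definition yang_baxter :: "('x \<times> 'x \<Rightarrow> 'x \<times> 'x) \<Rightarrow> bool" where
  "yang_baxter r \<longleftrightarrow>
     (\<forall>xs\<in>tuples 3. (at_pos r 1 \<circ> at_pos r 2 \<circ> at_pos r 1) xs = (at_pos r 2 \<circ> at_pos r 1 \<circ> at_pos r 2) xs)"

definition lam :: "('x \<times> 'x \<Rightarrow> 'x \<times> 'x) \<Rightarrow> 'x \<Rightarrow> 'x \<Rightarrow> 'x" where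
  "lam r a b = fst (r (a, b))"

definition rho :: "('x \<times> 'x \<Rightarrow> 'x \<times> 'x) \<Rightarrow> 'x \<Rightarrow> 'x \<Rightarrow> 'x" where
  "rho r b a = snd (r (a, b))"

definition right_non_degenerate :: "('x \<times> 'x \<Rightarrow> 'x \<times> 'x) \<Rightarrow> bool" where
  "right_non_degenerate r \<longleftrightarrow> (\<forall>b. bij (rho r b))"

text \<open>On \<open>X\<^sup>2\<close>, the map \<open>k\<^sub>2\<close> is \<^term>\<open>map_prod id k\<close>.\<close>

definition reflection :: "('x \<times> 'x \<Rightarrow> 'x \<times> 'x) \<Rightarrow> ('x \<Rightarrow> 'x) \<Rightarrow> bool" where
  "reflection r k \<longleftrightarrow>
     r \<circ> map_prod id k \<circ> r \<circ> map_prod id k = map_prod id k \<circ> r \<circ> map_prod id k \<circ> r"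

definition involutive_map :: "('x \<times> 'x \<Rightarrow> 'x \<times> 'x) \<Rightarrow> bool" where
  "involutive_map r \<longleftrightarrow> r ^^ 2 = id"

definition idempotent_map :: "('x \<times> 'x \<Rightarrow> 'x \<times> 'x) \<Rightarrow> bool" where
  "idempotent_map r \<longleftrightarrow> r ^^ 2 = r"

definition derived :: "('x \<times> 'x \<Rightarrow> 'x \<times> 'x) \<Rightarrow> ('x \<Rightarrow> 'x) \<Rightarrow> 'x \<times> 'x \<Rightarrow> 'x \<times> 'x" where
  "derived r k = (\<lambda>(a, b).
     let c = inv_into UNIV (rho r (k b)) a;
         a' = rho r b c;
         b' = rho r (k a') (lam r c b)
     in (b', a'))"

text \<open>
  The congruence generated by a set \<open>R\<close> of relations on the free monoid \<^term>\<open>lists A\<close>;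
  \<open>R\<close> is meant to relate words over \<open>A\<close>.
\<close>

inductive_set word_cong :: "'g set \<Rightarrow> ('g list \<times> 'g list) set \<Rightarrow> ('g list \<times> 'g list) set"
  for A :: "'g set" and R :: "('g list \<times> 'g list) set"
where
  refl: "w \<in> lists A \<Longrightarrow> (w, w) \<in> word_cong A R"
| step: "(u, v) \<in> R \<Longrightarrow> p \<in> lists A \<Longrightarrow> q \<in> lists A \<Longrightarrow> (p @ u @ q, p @ v @ q) \<in> word_cong A R"
| sym: "(u, v) \<in> word_cong A R \<Longrightarrow> (v, u) \<in> word_cong A R"
| trans: "(u, v) \<in> word_cong A R \<Longrightarrow> (v, w) \<in> word_cong A R \<Longrightarrow> (u, w) \<in> word_cong A R"

definition presented_monoid :: "'g set \<Rightarrow> ('g list \<times> 'g list) set \<Rightarrow> 'g list set monoid" where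
  "presented_monoid A R =
     \<lparr>carrier = lists A // word_cong A R,
      mult = (\<lambda>P Q. \<Union>p\<in>P. \<Union>q\<in>Q. word_cong A R `` {p @ q}),
      one = word_cong A R `` {[]}\<rparr>"

definition braid_rels :: "nat \<Rightarrow> (nat list \<times> nat list) set" where
  "braid_rels n =
     {([i, j], [j, i]) | i j. 1 \<le> i \<and> i + 2 \<le> j \<and> j < n} \<union>
     {([i, i + 1, i], [i + 1, i, i + 1]) | i. 1 \<le> i \<and> i + 1 < n}"

definition braid_monoid :: "nat \<Rightarrow> nat list set monoid" where
  "braid_monoid n = presented_monoid {1..<n} (braid_rels n)"

text \<open>
  The braid group is presented as a monoid on the letters \<open>(i, True)\<close>, standing for \<open>\<sigma>\<^sub>i\<close>, and
  \<open>(i, False)\<close>, standing for its inverse, with the cancellation relations added to the braid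
  relations.
\<close>

definition braid_group_rels :: "nat \<Rightarrow> ((nat \<times> bool) list \<times> (nat \<times> bool) list) set" where
  "braid_group_rels n =
     {(map (\<lambda>i. (i, True)) u, map (\<lambda>i. (i, True)) v) | u v. (u, v) \<in> braid_rels n} \<union>
     {([(i, e), (i, \<not> e)], []) | i e. i \<in> {1..<n}}"

definition braid_group :: "nat \<Rightarrow> (nat \<times> bool) list set monoid" where
  "braid_group n = presented_monoid ({1..<n} \<times> UNIV) (braid_group_rels n)"

text \<open>Left actions by arbitrary self-maps; the group case is \<^locale>\<open>group_action\<close>.\<close>

locale monoid_action = monoid M for M (structure) +
  fixes E :: "'e set" and \<phi> :: "'a \<Rightarrow> 'e \<Rightarrow> 'e"
  assumes act_closed: "g \<in> carrier M \<Longrightarrow> x \<in> E \<Longrightarrow> \<phi> g x \<in> E"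
    and act_one: "x \<in> E \<Longrightarrow> \<phi> \<one> x = x"
    and act_mult: "g \<in> carrier M \<Longrightarrow> h \<in> carrier M \<Longrightarrow> x \<in> E \<Longrightarrow> \<phi> (g \<otimes> h) x = \<phi> g (\<phi> h x)"

definition isomorphic_actions ::
  "('a, 'm) monoid_scheme \<Rightarrow> 'e set \<Rightarrow> ('a \<Rightarrow> 'e \<Rightarrow> 'e) \<Rightarrow> 'f set \<Rightarrow> ('a \<Rightarrow> 'f \<Rightarrow> 'f) \<Rightarrow> bool" where
  "isomorphic_actions M E \<phi> F \<psi> \<longleftrightarrow>
     (\<exists>J. bij_betw J E F \<and> (\<forall>g\<in>carrier M. \<forall>x\<in>E. J (\<phi> g x) = \<psi> g (J x)))"

text \<open>
  A word acts through its letters, the rightmost letter first. A braid is a class of words, and it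
  acts by the common value of the actions of its representatives; \<^const>\<open>the_elem\<close> is meaningful
  because these agree if \<open>r\<close> satisfies the Yang--Baxter equation (and, for the braid group, is
  bijective). Restricting to \<open>X\<^sup>n\<close> makes the maps elements of \<^term>\<open>carrier (BijGroup (tuples n))\<close>,
  as \<^locale>\<open>group_action\<close> requires.
\<close>

definition braid_monoid_act ::
  "nat \<Rightarrow> ('x \<times> 'x \<Rightarrow> 'x \<times> 'x) \<Rightarrow> nat list set \<Rightarrow> 'x list \<Rightarrow> 'x list" where
  "braid_monoid_act n r \<beta> =
     the_elem ((\<lambda>w. restrict (foldr (at_pos r) w) (tuples n)) ` \<beta>)"

definition signed_at_pos ::
  "nat \<Rightarrow> ('x \<times> 'x \<Rightarrow> 'x \<times> 'x) \<Rightarrow> nat \<times> bool \<Rightarrow> 'x list \<Rightarrow> 'x list" where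
  "signed_at_pos n r = (\<lambda>(i, e). if e then at_pos r i else inv_into (tuples n) (at_pos r i))"

definition braid_group_act ::
  "nat \<Rightarrow> ('x \<times> 'x \<Rightarrow> 'x \<times> 'x) \<Rightarrow> (nat \<times> bool) list set \<Rightarrow> 'x list \<Rightarrow> 'x list" where
  "braid_group_act n r \<beta> =
     the_elem ((\<lambda>w. restrict (foldr (signed_at_pos n r) w) (tuples n)) ` \<beta>)"

end

theory Submission
  imports Defs
begin

text \<open>
  Everything rests on one bijection \<open>J\<close> of \<open>X\<^sup>n\<close>, a generalised guitar map, which turns each
  \<open>r\<^sub>i\<close> into the map \<open>r\<^sup>(\<^sup>k\<^sup>)\<^sub>i\<close>. A family of bijections that intertwines the generators intertwines
  everything built from them, so the Yang--Baxter equation, the monoid and group actions, the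
  relations between powers, and bijectivity all pass between \<open>r\<close> and \<open>r\<^sup>(\<^sup>k\<^sup>)\<close>.

  For \<open>n = 2\<close> the map is \<open>J(c, b) = (\<rho>\<^bsub>k(b)\<^esub>(c), b)\<close>, and \<open>J r = r\<^sup>(\<^sup>k\<^sup>) J\<close> is just the definition of
  \<open>r\<^sup>(\<^sup>k\<^sup>)\<close> read off with the preimage \<open>c\<close> in place of \<open>\<rho>\<^bsub>k(b)\<^esub>\<^sup>-\<^sup>1(a)\<close>. For larger \<open>n\<close>, let \<open>T\<^sub>y\<close> be the
  effect on a tuple of pulling a strand coloured \<open>y\<close> through it from right to left, and set
  \<open>J(x\<^sub>1, \<dots>, x\<^sub>n, c) = (J(T\<^bsub>k(c)\<^esub>(x\<^sub>1, \<dots>, x\<^sub>n)), c)\<close>. The Yang--Baxter equation gives two facts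
  about \<open>T\<close>: each \<open>T\<^sub>y\<close> commutes with every \<open>r\<^sub>i\<close>, and \<open>T\<^sub>y T\<^sub>x\<close> does not change when \<open>(x, y)\<close> is
  replaced by \<open>r(x, y)\<close> (lemmas \<open>pull_apply_back\<close> and \<open>pull_pull\<close>). The first lets an induction on
  \<open>n\<close> handle all \<open>r\<^sub>i\<close> except the one at the last two places \<open>(b, c)\<close>. There the rest of the tuple
  is acted on by \<open>T\<^sub>y T\<^sub>x\<close> with \<open>(x, y) = k\<^sub>2 r k\<^sub>2 (b, c)\<close>; replacing \<open>(b, c)\<close> by \<open>r(b, c)\<close> changes
  \<open>(x, y)\<close> into \<open>k\<^sub>2 r k\<^sub>2 r (b, c) = r k\<^sub>2 r k\<^sub>2 (b, c) = r(x, y)\<close> by the reflection equation, which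
  the second fact makes harmless (lemma \<open>guitar_apply_back\<close>). Right-non-degeneracy makes the
  \<open>T\<^sub>y\<close>, and hence \<open>J\<close>, bijective.
\<close>

section \<open>Monoids and groups given by generators and relations\<close>

lemma word_cong_in_lists:
  assumes "R \<subseteq> lists A \<times> lists A" and "(u, v) \<in> word_cong A R"
  shows "u \<in> lists A \<and> v \<in> lists A"
  using assms(2) by (induction rule: word_cong.induct) (use assms(1) in auto)

lemma equiv_word_cong:
  assumes "R \<subseteq> lists A \<times> lists A"
  shows "equiv (lists A) (word_cong A R)"
proof (rule equivI)
  show "word_cong A R \<subseteq> lists A \<times> lists A"
    using word_cong_in_lists[OF assms] by auto
  show "refl_on (lists A) (word_cong A R)"
    by (auto simp: refl_on_def intro: word_cong.refl)
  show "sym (word_cong A R)" by (rule symI) (rule word_cong.sym)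
  show "trans (word_cong A R)" by (rule transI) (rule word_cong.trans)
qed

lemma word_cong_context:
  assumes "(u, v) \<in> word_cong A R" and "p \<in> lists A" and "q \<in> lists A"
  shows "(p @ u @ q, p @ v @ q) \<in> word_cong A R"
  using assms(1)
proof (induction rule: word_cong.induct)
  case (refl w)
  then show ?case using assms by (intro word_cong.refl) auto
next
  case (step u v p' q')
  have "((p @ p') @ u @ (q' @ q), (p @ p') @ v @ (q' @ q)) \<in> word_cong A R"
    using step assms by (intro word_cong.step) auto
  then show ?case by simp
next
  case (sym u v)
  show ?case using sym.IH by (rule word_cong.sym)
next
  case (trans u v w)
  show ?case using trans.IH by (rule word_cong.trans)
qed

lemma word_cong_append:
  assumes R: "R \<subseteq> lists A \<times> lists A"
    and "(u, u') \<in> word_cong A R" and "(v, v') \<in> word_cong A R"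
  shows "(u @ v, u' @ v') \<in> word_cong A R"
proof -
  have "(u @ v, u' @ v) \<in> word_cong A R"
    using word_cong_context[of u u' A R "[]" v] word_cong_in_lists[OF R] assms by simp
  moreover have "(u' @ v, u' @ v') \<in> word_cong A R"
    using word_cong_context[of v v' A R u' "[]"] word_cong_in_lists[OF R] assms by simp
  ultimately show ?thesis by (rule word_cong.trans)
qed

lemma presented_monoid_mult:
  assumes R: "R \<subseteq> lists A \<times> lists A" and u: "u \<in> lists A" and v: "v \<in> lists A"
  shows "(word_cong A R `` {u}) \<otimes>\<^bsub>presented_monoid A R\<^esub> (word_cong A R `` {v})
           = word_cong A R `` {u @ v}"
proof -
  have "word_cong A R `` {p @ q} = word_cong A R `` {u @ v}"
    if "p \<in> word_cong A R `` {u}" "q \<in> word_cong A R `` {v}" for p q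
    using equiv_class_eq[OF equiv_word_cong[OF R] word_cong_append[OF R, of u p v q]] that by simp
  then have "(\<Union>p\<in>word_cong A R `` {u}. \<Union>q\<in>word_cong A R `` {v}. word_cong A R `` {p @ q})
      = (\<Union>p\<in>word_cong A R `` {u}. \<Union>q\<in>word_cong A R `` {v}. word_cong A R `` {u @ v})"
    by (intro SUP_cong) simp_all
  also have "\<dots> = word_cong A R `` {u @ v}"
    using equiv_class_self[OF equiv_word_cong[OF R]] u v by auto
  finally show ?thesis by (simp add: presented_monoid_def)
qed

lemma carrier_presented_monoidE:
  assumes "g \<in> carrier (presented_monoid A R)"
  obtains u where "u \<in> lists A" and "g = word_cong A R `` {u}"
  using assms by (auto simp: presented_monoid_def quotient_def)

lemma class_in_carrier:
  "u \<in> lists A \<Longrightarrow> word_cong A R `` {u} \<in> carrier (presented_monoid A R)"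
  by (simp add: presented_monoid_def quotientI)

lemma one_presented_monoid: "\<one>\<^bsub>presented_monoid A R\<^esub> = word_cong A R `` {[]}"
  by (simp add: presented_monoid_def)

lemma monoid_presented_monoid:
  assumes R: "R \<subseteq> lists A \<times> lists A"
  shows "monoid (presented_monoid A R)"
proof (rule monoidI)
  note mult = presented_monoid_mult[OF R]
  show "\<one>\<^bsub>presented_monoid A R\<^esub> \<in> carrier (presented_monoid A R)"
    by (simp add: one_presented_monoid class_in_carrier)
  fix x assume "x \<in> carrier (presented_monoid A R)"
  then obtain u where u: "u \<in> lists A" "x = word_cong A R `` {u}"
    by (rule carrier_presented_monoidE)
  show "\<one>\<^bsub>presented_monoid A R\<^esub> \<otimes>\<^bsub>presented_monoid A R\<^esub> x = x"
    "x \<otimes>\<^bsub>presented_monoid A R\<^esub> \<one>\<^bsub>presented_monoid A R\<^esub> = x"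
    using mult[of "[]" u] mult[of u "[]"] u by (simp_all add: one_presented_monoid)
  fix y assume "y \<in> carrier (presented_monoid A R)"
  then obtain v where v: "v \<in> lists A" "y = word_cong A R `` {v}"
    by (rule carrier_presented_monoidE)
  show "x \<otimes>\<^bsub>presented_monoid A R\<^esub> y \<in> carrier (presented_monoid A R)"
    using mult[of u v] u v class_in_carrier[of "u @ v" A R] by simp
  fix z assume "z \<in> carrier (presented_monoid A R)"
  then obtain w where w: "w \<in> lists A" "z = word_cong A R `` {w}"
    by (rule carrier_presented_monoidE)
  show "x \<otimes>\<^bsub>presented_monoid A R\<^esub> y \<otimes>\<^bsub>presented_monoid A R\<^esub> z
        = x \<otimes>\<^bsub>presented_monoid A R\<^esub> (y \<otimes>\<^bsub>presented_monoid A R\<^esub> z)"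
    using mult[of u v] mult[of v w] mult[of "u @ v" w] mult[of u "v @ w"] u v w by simp
qed

text \<open>
  The left inverses of the letters of a word, multiplied in the opposite order, cancel the word; a
  monoid with left inverses is a group.
\<close>

lemma group_presented_monoid:
  assumes R: "R \<subseteq> lists A \<times> lists A"
    and cancel: "\<And>a. a \<in> A \<Longrightarrow> \<exists>b\<in>A. ([b, a], []) \<in> R"
  shows "group (presented_monoid A R)"
proof -
  interpret monoid "presented_monoid A R" by (rule monoid_presented_monoid[OF R])
  have inv: "\<exists>v\<in>lists A. (v @ u, []) \<in> word_cong A R" if "u \<in> lists A" for u
    using that
  proof (induction u)
    case Nil
    then show ?case by (auto intro: word_cong.refl)
  next
    case (Cons a u)
    then obtain v where v: "v \<in> lists A" "(v @ u, []) \<in> word_cong A R" by auto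
    obtain b where b: "b \<in> A" "([b, a], []) \<in> R" using cancel[of a] Cons by auto
    have "(v @ [b, a] @ u, v @ [] @ u) \<in> word_cong A R"
      using v b Cons by (intro word_cong.step) auto
    then have "((v @ [b]) @ a # u, []) \<in> word_cong A R"
      using word_cong.trans[OF _ v(2)] by simp
    then show ?case using v b by (intro bexI[of _ "v @ [b]"]) auto
  qed
  show ?thesis
  proof (rule group_l_invI)
    fix x assume "x \<in> carrier (presented_monoid A R)"
    then obtain u where u: "u \<in> lists A" "x = word_cong A R `` {u}"
      by (rule carrier_presented_monoidE)
    obtain v where v: "v \<in> lists A" "(v @ u, []) \<in> word_cong A R" using inv u by blast
    have "word_cong A R `` {v} \<otimes>\<^bsub>presented_monoid A R\<^esub> x = \<one>\<^bsub>presented_monoid A R\<^esub>"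
      using u v equiv_class_eq[OF equiv_word_cong[OF R] v(2)]
      by (simp add: presented_monoid_mult[OF R] one_presented_monoid)
    then show "\<exists>y\<in>carrier (presented_monoid A R).
        y \<otimes>\<^bsub>presented_monoid A R\<^esub> x = \<one>\<^bsub>presented_monoid A R\<^esub>"
      by (rule bexI[OF _ class_in_carrier[OF v(1)]])
  qed
qed

section \<open>Actions given on generators\<close>

definition word_act :: "'e set \<Rightarrow> ('g \<Rightarrow> 'e \<Rightarrow> 'e) \<Rightarrow> 'g list set \<Rightarrow> 'e \<Rightarrow> 'e" where
  "word_act E f \<beta> = the_elem ((\<lambda>w. restrict (foldr f w) E) ` \<beta>)"

locale word_action =
  fixes A :: "'g set" and R :: "('g list \<times> 'g list) set" and E :: "'e set"
    and f :: "'g \<Rightarrow> 'e \<Rightarrow> 'e"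
  assumes relations: "R \<subseteq> lists A \<times> lists A"
    and letter_closed: "a \<in> A \<Longrightarrow> x \<in> E \<Longrightarrow> f a x \<in> E"
    and letter_relations: "(u, v) \<in> R \<Longrightarrow> x \<in> E \<Longrightarrow> foldr f u x = foldr f v x"
begin

lemma word_closed: "w \<in> lists A \<Longrightarrow> x \<in> E \<Longrightarrow> foldr f w x \<in> E"
  by (induction w) (auto intro: letter_closed)

lemma word_cong_act:
  "(u, v) \<in> word_cong A R \<Longrightarrow> x \<in> E \<Longrightarrow> foldr f u x = foldr f v x"
  by (induction arbitrary: x rule: word_cong.induct)
    (auto simp: word_closed letter_relations)

lemma word_act_class:
  assumes "u \<in> lists A"
  shows "word_act E f (word_cong A R `` {u}) = restrict (foldr f u) E"
proof -
  have "(\<lambda>w. restrict (foldr f w) E) ` (word_cong A R `` {u}) = {restrict (foldr f u) E}"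
  proof -
    have "restrict (foldr f w) E = restrict (foldr f u) E" if "(u, w) \<in> word_cong A R" for w
      using word_cong_act[OF that] by (auto simp: restrict_def)
    moreover have "(u, u) \<in> word_cong A R" using assms by (rule word_cong.refl)
    ultimately show ?thesis by blast
  qed
  then show ?thesis by (simp add: word_act_def)
qed

lemma monoid_action_word_act: "monoid_action (presented_monoid A R) E (word_act E f)"
proof -
  interpret monoid "presented_monoid A R" by (rule monoid_presented_monoid[OF relations])
  show ?thesis
  proof
    fix g h x
    assume "g \<in> carrier (presented_monoid A R)"
    then obtain u where u: "u \<in> lists A" "g = word_cong A R `` {u}"
      by (rule carrier_presented_monoidE)
    assume x: "x \<in> E"
    show "word_act E f g x \<in> E"
      using u x word_act_class[of u] word_closed[of u x] by simp
    assume "h \<in> carrier (presented_monoid A R)"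
    then obtain v where v: "v \<in> lists A" "h = word_cong A R `` {v}"
      by (rule carrier_presented_monoidE)
    show "word_act E f (g \<otimes>\<^bsub>presented_monoid A R\<^esub> h) x
        = word_act E f g (word_act E f h x)"
      using u v x word_act_class[of u] word_act_class[of v] word_act_class[of "u @ v"]
        word_closed[of v x] presented_monoid_mult[OF relations, of u v]
      by simp
  qed (simp add: one_presented_monoid word_act_class)
qed

lemma word_act_extensional:
  assumes "g \<in> carrier (presented_monoid A R)"
  shows "word_act E f g \<in> extensional E"
proof -
  obtain u where "u \<in> lists A" "g = word_cong A R `` {u}"
    using assms by (rule carrier_presented_monoidE)
  then show ?thesis using word_act_class[of u] by simp
qed

text \<open>
  It suffices to intertwine the letters: a braid acts through any of its words, letter by letter.
\<close>

lemma isomorphic_word_act: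
  assumes "word_action A R F g" and J: "bij_betw J E F"
    and comm: "\<And>a x. a \<in> A \<Longrightarrow> x \<in> E \<Longrightarrow> J (f a x) = g a (J x)"
  shows "isomorphic_actions (presented_monoid A R) E (word_act E f) F (word_act F g)"
proof -
  interpret F: word_action A R F g by fact
  have JF: "J x \<in> F" if "x \<in> E" for x using J that by (auto simp: bij_betw_def)
  have word: "J (foldr f w x) = foldr g w (J x)" if "w \<in> lists A" "x \<in> E" for w x
    using that by (induction w) (auto simp: comm word_closed)
  have "J (word_act E f c x) = word_act F g c (J x)"
    if c: "c \<in> carrier (presented_monoid A R)" and x: "x \<in> E" for c x
  proof -
    obtain u where "u \<in> lists A" "c = word_cong A R `` {u}"
      using c by (rule carrier_presented_monoidE)
    then show ?thesis
      using word_act_class[of u] F.word_act_class[of u] word[of u x] x JF[of x] by simp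
  qed
  then show ?thesis
    unfolding isomorphic_actions_def using J by blast
qed

end

text \<open>
  The inverse group element acts by the inverse map. Extensionality places the maps in
  \<^term>\<open>BijGroup E\<close>, whose elements are normalised outside \<open>E\<close>.
\<close>

lemma (in monoid_action) group_action_if_group:
  assumes "group M" and ext: "\<And>g. g \<in> carrier M \<Longrightarrow> \<phi> g \<in> extensional E"
  shows "group_action M E \<phi>"
proof -
  interpret group M by fact
  have Bij: "\<phi> g \<in> Bij E" if g: "g \<in> carrier M" for g
  proof -
    have "bij_betw (\<phi> g) E E"
    proof (rule bij_betw_byWitness[where f' = "\<phi> (inv g)"])
      show "\<forall>a\<in>E. \<phi> (inv g) (\<phi> g a) = a" "\<forall>a\<in>E. \<phi> g (\<phi> (inv g) a) = a"
        using g by (auto simp: act_mult[symmetric] act_one)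
    qed (use g in \<open>auto intro: act_closed\<close>)
    then show ?thesis using ext[OF g] by (simp add: Bij_def)
  qed
  have "\<phi> (g \<otimes> h) = compose E (\<phi> g) (\<phi> h)" if "g \<in> carrier M" "h \<in> carrier M" for g h
    using that ext by (intro extensionalityI[of _ E]) (auto simp: act_mult compose_eq)
  then show ?thesis
    using Bij
    by (intro group_action.intro group_hom.intro group_hom_axioms.intro homI)
      (auto simp: BijGroup_def group_BijGroup[unfolded BijGroup_def] intro: \<open>group M\<close>)
qed

section \<open>Braid monoid and braid group actions of a solution\<close>

lemma braid_rels_lists: "braid_rels n \<subseteq> lists {1..<n} \<times> lists {1..<n}"
  by (auto simp: braid_rels_def)

lemma braid_group_rels_lists:
  "braid_group_rels n \<subseteq> lists ({1..<n} \<times> UNIV) \<times> lists ({1..<n} \<times> UNIV)"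
  using braid_rels_lists[of n] by (fastforce simp: braid_group_rels_def)

lemma group_braid_group: "group (braid_group n)"
  unfolding braid_group_def
proof (rule group_presented_monoid[OF braid_group_rels_lists])
  fix a :: "nat \<times> bool" assume "a \<in> {1..<n} \<times> UNIV"
  then obtain i e where a: "a = (i, e)" "i \<in> {1..<n}" by auto
  have "([(i, \<not> e), (i, \<not> \<not> e)], []) \<in> braid_group_rels n"
    unfolding braid_group_rels_def using a(2) by blast
  then show "\<exists>b\<in>{1..<n} \<times> UNIV. ([b, a], []) \<in> braid_group_rels n"
    using a by (intro bexI[of _ "(i, \<not> e)"]) auto
qed

lemma at_pos_append:
  "at_pos r (Suc (length us)) (us @ a # b # vs) = us @ lam r a b # rho r b a # vs"
  by (auto simp: at_pos_def lam_def rho_def nth_append list_update_append split: prod.splits)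

lemma tuple_split:
  assumes "xs \<in> tuples n" and "1 \<le> i" and "i < n"
  obtains us a b vs where "xs = us @ a # b # vs" and "i = Suc (length us)"
    and "length vs = n - 1 - i"
proof
  have "length xs = n" using assms by (simp add: tuples_def)
  then show "xs = take (i - 1) xs @ xs ! (i - 1) # xs ! i # drop (Suc i) xs"
    using assms id_take_nth_drop[of "i - 1" xs] Cons_nth_drop_Suc[of i xs] by auto
  show "i = Suc (length (take (i - 1) xs))" "length (drop (Suc i) xs) = n - 1 - i"
    using assms \<open>length xs = n\<close> by auto
qed

lemma at_pos_tuples: "at_pos r i xs \<in> tuples n \<longleftrightarrow> xs \<in> tuples n"
  by (simp add: at_pos_def tuples_def split: prod.splits)

lemma yang_baxter_components:
  "yang_baxter r \<longleftrightarrow> (\<forall>a b c.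
     lam r (lam r a b) (lam r (rho r b a) c) = lam r a (lam r b c) \<and>
     rho r (lam r (rho r b a) c) (lam r a b) = lam r (rho r (lam r b c) a) (rho r c b) \<and>
     rho r c (rho r b a) = rho r (rho r c b) (rho r (lam r b c) a))"
proof -
  have tuples3: "(\<forall>xs\<in>tuples 3. P xs) \<longleftrightarrow> (\<forall>a b c. P [a, b, c])" for P :: "'a list \<Rightarrow> bool"
    by (auto simp: tuples_def numeral_3_eq_3 length_Suc_conv)
  have "at_pos r (Suc 0) [a, b, c] = [lam r a b, rho r b a, c]"
    "at_pos r 2 [a, b, c] = [a, lam r b c, rho r c b]" for a b c
    using at_pos_append[of r "[]"] at_pos_append[of r "[a]" b c "[]"]
    by (simp_all add: numeral_2_eq_2)
  then show ?thesis
    unfolding yang_baxter_def tuples3 by simp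
qed

lemma at_pos_braid:
  assumes "yang_baxter r" and "1 \<le> i" and "i + 1 < n" and "xs \<in> tuples n"
  shows "at_pos r i (at_pos r (i + 1) (at_pos r i xs))
       = at_pos r (i + 1) (at_pos r i (at_pos r (i + 1) xs))"
proof -
  obtain us a b vs where xs: "xs = us @ a # b # vs" "i = Suc (length us)"
    and "length vs = n - 1 - i"
    by (rule tuple_split[of xs n i]) (use assms in auto)
  then obtain c ws where vs: "vs = c # ws" using assms by (cases vs) auto
  show ?thesis
    using assms(1) at_pos_append[of r us]
      at_pos_append[of r "us @ [x]" for x]
    unfolding xs vs yang_baxter_components by simp
qed

lemma at_pos_far_commute:
  assumes "1 \<le> i" and "i + 2 \<le> j" and "j < n" and "xs \<in> tuples n"
  shows "at_pos r i (at_pos r j xs) = at_pos r j (at_pos r i xs)"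
proof -
  obtain us a b vs where xs: "xs = us @ a # b # vs" "i = Suc (length us)"
    and len: "length vs = n - 1 - i"
    by (rule tuple_split[of xs n i]) (use assms in auto)
  have "vs \<in> tuples (n - 1 - i)" using len by (simp add: tuples_def)
  moreover have "1 \<le> j - 1 - i" "j - 1 - i < n - 1 - i" using assms by auto
  ultimately obtain ms c d ws where vs: "vs = ms @ c # d # ws" "j - 1 - i = Suc (length ms)"
    by (rule tuple_split)
  have j: "j = Suc (length (us @ x # y # ms))" for x y :: 'a
    using vs(2) xs(2) assms by simp
  have at_j: "at_pos r j (us @ x # y # ms @ c # d # ws)
      = us @ x # y # ms @ lam r c d # rho r d c # ws" for x y
    using at_pos_append[of r "us @ x # y # ms" c d ws, folded j] by simp
  show ?thesis
    unfolding xs(1) vs(1) at_j unfolding xs(2) at_pos_append using at_j by simp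
qed

lemma word_action_at_pos:
  assumes "yang_baxter r"
  shows "word_action {1..<n} (braid_rels n) (tuples n) (at_pos r)"
proof
  fix u v and xs :: "'a list"
  assume "(u, v) \<in> braid_rels n" and "xs \<in> tuples n"
  then show "foldr (at_pos r) u xs = foldr (at_pos r) v xs"
    using at_pos_far_commute[of _ _ n xs r] at_pos_braid[OF assms, of _ n xs]
    by (auto simp: braid_rels_def)
qed (use braid_rels_lists[of n] in \<open>simp_all add: at_pos_tuples\<close>)

text \<open>
  The inverse of \<open>r\<^sub>i\<close> on \<open>X\<^sup>n\<close> is \<open>(r\<^sup>-\<^sup>1)\<^sub>i\<close>.
\<close>

lemma bij_betw_at_pos:
  assumes "bij r" and "1 \<le> i" and "i < n"
  shows "bij_betw (at_pos r i) (tuples n) (tuples n)"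
proof -
  have cancel: "at_pos q i (at_pos p i xs) = xs"
    if qp: "\<And>z. q (p z) = z" and xs_n: "xs \<in> tuples n" for p q :: "'a \<times> 'a \<Rightarrow> 'a \<times> 'a" and xs
  proof -
    obtain us a b vs where xs: "xs = us @ a # b # vs" "i = Suc (length us)"
      by (rule tuple_split[OF xs_n assms(2,3)])
    show ?thesis
      using qp[of "(a, b)"] by (simp add: xs at_pos_append) (simp add: lam_def rho_def)
  qed
  show ?thesis
  proof (rule bij_betw_byWitness[where f' = "at_pos (inv_into UNIV r) i"])
    show "\<forall>xs\<in>tuples n. at_pos (inv_into UNIV r) i (at_pos r i xs) = xs"
      using cancel[of "inv_into UNIV r" r] assms(1) by (simp add: bij_is_inj)
    show "\<forall>xs\<in>tuples n. at_pos r i (at_pos (inv_into UNIV r) i xs) = xs"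
      using cancel[of r "inv_into UNIV r"] assms(1) by (simp add: bij_is_surj surj_f_inv_f)
  qed (auto simp: at_pos_tuples)
qed

lemma word_action_signed_at_pos:
  assumes "yang_baxter r" and "bij r"
  shows "word_action ({1..<n} \<times> UNIV) (braid_group_rels n) (tuples n) (signed_at_pos n r)"
proof
  interpret pos: word_action "{1..<n}" "braid_rels n" "tuples n" "at_pos r"
    by (rule word_action_at_pos) fact
  note bij = bij_betw_at_pos[OF assms(2), of _ n]
  show "signed_at_pos n r a xs \<in> tuples n"
    if "a \<in> {1..<n} \<times> UNIV" "xs \<in> tuples n" for a xs
  proof -
    obtain i e where a: "a = (i, e)" by (cases a)
    have "inv_into (tuples n) (at_pos r i) xs \<in> tuples n"
      using bij[of i] that a by (intro inv_into_into) (auto simp: bij_betw_def)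
    then show ?thesis using that a by (simp add: signed_at_pos_def at_pos_tuples)
  qed
  have pos_word: "foldr (signed_at_pos n r) (map (\<lambda>i. (i, True)) w) = foldr (at_pos r) w" for w
    by (induction w) (auto simp: signed_at_pos_def)
  show "foldr (signed_at_pos n r) u xs = foldr (signed_at_pos n r) v xs"
    if "(u, v) \<in> braid_group_rels n" "xs \<in> tuples n" for u v xs
    using that(1) unfolding braid_group_rels_def
  proof
    assume "(u, v) \<in> {(map (\<lambda>i. (i, True)) u, map (\<lambda>i. (i, True)) v) |u v. (u, v) \<in> braid_rels n}"
    then show ?thesis using that(2) by (auto simp: pos_word pos.letter_relations)
  next
    assume "(u, v) \<in> {([(i, e), (i, \<not> e)], []) |i e. i \<in> {1..<n}}"
    then obtain i e where uv: "u = [(i, e), (i, \<not> e)]" "v = []" "1 \<le> i" "i < n" by auto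
    show ?thesis
      using bij_betw_inv_into_left[OF bij[OF uv(3,4)] that(2)]
        bij_betw_inv_into_right[OF bij[OF uv(3,4)] that(2)] uv
      by (cases e) (auto simp: signed_at_pos_def)
  qed
qed (rule braid_group_rels_lists)

lemma braid_monoid_act_eq: "braid_monoid_act n r = word_act (tuples n) (at_pos r)"
  by (simp add: fun_eq_iff braid_monoid_act_def word_act_def)

lemma braid_group_act_eq: "braid_group_act n r = word_act (tuples n) (signed_at_pos n r)"
  by (simp add: fun_eq_iff braid_group_act_def word_act_def)

lemma monoid_action_braid_monoid:
  "yang_baxter r \<Longrightarrow> monoid_action (braid_monoid n) (tuples n) (braid_monoid_act n r)"
  unfolding braid_monoid_act_eq braid_monoid_def
  by (intro word_action.monoid_action_word_act word_action_at_pos)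

lemma group_action_braid_group:
  assumes "yang_baxter r" and "bij r"
  shows "group_action (braid_group n) (tuples n) (braid_group_act n r)"
proof -
  interpret word_action "{1..<n} \<times> UNIV" "braid_group_rels n" "tuples n" "signed_at_pos n r"
    using assms by (rule word_action_signed_at_pos)
  show ?thesis
    unfolding braid_group_act_eq braid_group_def
    by (rule monoid_action.group_action_if_group[OF monoid_action_word_act
          group_braid_group[unfolded braid_group_def] word_act_extensional])
qed

lemma isomorphic_braid_monoid_actions:
  assumes "yang_baxter r" and "yang_baxter s" and "bij_betw J (tuples n) (tuples n)"
    and "\<And>i xs. 1 \<le> i \<Longrightarrow> i < n \<Longrightarrow> xs \<in> tuples n \<Longrightarrow> J (at_pos r i xs) = at_pos s i (J xs)"
  shows "isomorphic_actions (braid_monoid n) (tuples n) (braid_monoid_act n r)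
    (tuples n) (braid_monoid_act n s)"
  unfolding braid_monoid_act_eq braid_monoid_def
  by (rule word_action.isomorphic_word_act[OF word_action_at_pos[OF assms(1)]
        word_action_at_pos[OF assms(2)] assms(3)]) (use assms(4) in auto)

text \<open>
  A bijection that intertwines \<open>r\<^sub>i\<close> and \<open>s\<^sub>i\<close> also intertwines their inverses, so the same bijection
  serves the braid monoid and the braid group.
\<close>

lemma isomorphic_braid_group_actions:
  assumes "yang_baxter r" and "yang_baxter s" and "bij r" and "bij s"
    and J: "bij_betw J (tuples n) (tuples n)"
    and comm: "\<And>i xs. 1 \<le> i \<Longrightarrow> i < n \<Longrightarrow> xs \<in> tuples n \<Longrightarrow> J (at_pos r i xs) = at_pos s i (J xs)"
  shows "isomorphic_actions (braid_group n) (tuples n) (braid_group_act n r)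
    (tuples n) (braid_group_act n s)"
  unfolding braid_group_act_eq braid_group_def
proof (rule word_action.isomorphic_word_act[OF word_action_signed_at_pos[OF assms(1,3)]
      word_action_signed_at_pos[OF assms(2,4)] J])
  fix a :: "nat \<times> bool" and xs :: "'a list"
  assume a: "a \<in> {1..<n} \<times> UNIV" and xs: "xs \<in> tuples n"
  obtain i e where ie: "a = (i, e)" "1 \<le> i" "i < n" using a by auto
  define ys where "ys = inv_into (tuples n) (at_pos r i) xs"
  have ys: "ys \<in> tuples n" "at_pos r i ys = xs"
    using bij_betw_at_pos[OF assms(3) ie(2,3)] xs unfolding ys_def
    by (auto simp: bij_betw_def inv_into_into bij_betw_inv_into_right f_inv_into_f)
  have "J ys = inv_into (tuples n) (at_pos s i) (at_pos s i (J ys))"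
    using bij_betw_inv_into_left[OF bij_betw_at_pos[OF assms(4) ie(2,3)]] J ys(1)
    by (metis bij_betwE)
  then have "J ys = inv_into (tuples n) (at_pos s i) (J xs)"
    using comm[OF ie(2,3) ys(1)] ys(2) by simp
  then show "J (signed_at_pos n r a xs) = signed_at_pos n s a (J xs)"
    using comm[OF ie(2,3) xs] ie by (simp add: signed_at_pos_def ys_def)
qed

section \<open>The guitar map of a reflection\<close>

text \<open>
  The guitar map peels a tuple from its last entry on, so it is defined on reversed tuples: the
  head of a list stands for the rightmost coordinate. In this encoding \<open>apply_back r j\<close> applies
  \<open>r\<close> to the two neighbours that have \<open>j\<close> entries on their right.
\<close>

fun apply_back :: "('x \<times> 'x \<Rightarrow> 'x \<times> 'x) \<Rightarrow> nat \<Rightarrow> 'x list \<Rightarrow> 'x list" where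
  "apply_back r 0 (b # a # xs) = rho r b a # lam r a b # xs"
| "apply_back r (Suc j) (c # xs) = c # apply_back r j xs"
| "apply_back r _ xs = xs"

lemma apply_back_append:
  "apply_back r (length vs) (vs @ b # a # us) = vs @ rho r b a # lam r a b # us"
  by (induction vs) auto

lemma at_pos_eq_apply_back:
  assumes "xs \<in> tuples n" and "1 \<le> i" and "i < n"
  shows "at_pos r i xs = rev (apply_back r (n - 1 - i) (rev xs))"
proof -
  obtain us a b vs where xs: "xs = us @ a # b # vs" "i = Suc (length us)" "length vs = n - 1 - i"
    using assms by (rule tuple_split)
  have "apply_back r (n - 1 - i) (rev xs) = rev vs @ rho r b a # lam r a b # rev us"
    using apply_back_append[of r "rev vs" b a "rev us"] xs by simp
  then show ?thesis by (simp add: xs at_pos_append)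
qed

text \<open>
  \<open>pull r y\<close> records the colours of the strands of a tuple after a strand entering on the right
  with colour \<open>y\<close> has been pulled across all of them; that strand changes colour at each crossing.
\<close>

fun pull :: "('x \<times> 'x \<Rightarrow> 'x \<times> 'x) \<Rightarrow> 'x \<Rightarrow> 'x list \<Rightarrow> 'x list" where
  "pull r y [] = []"
| "pull r y (b # xs) = rho r y b # pull r (lam r b y) xs"

lemma length_pull [simp]: "length (pull r y xs) = length xs"
  by (induction xs arbitrary: y) auto

text \<open>Sliding a strand across a crossing is the Yang--Baxter equation.\<close>

lemma pull_apply_back:
  assumes "yang_baxter r" and "Suc j < length xs"
  shows "pull r y (apply_back r j xs) = apply_back r j (pull r y xs)"
  using assms(2)
proof (induction j arbitrary: xs y)
  case 0
  then obtain b a zs where "xs = b # a # zs"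
    by (cases xs; cases "tl xs") auto
  then show ?case using assms(1) by (simp add: yang_baxter_components)
next
  case (Suc j)
  then show ?case by (cases xs) auto
qed

text \<open>
  Two strands may cross before or after being pulled across the tuple. This is again the
  Yang--Baxter equation, applied once for each entry of the tuple.
\<close>

lemma pull_pull:
  assumes "yang_baxter r"
  shows "pull r y (pull r x xs) = pull r (rho r y x) (pull r (lam r x y) xs)"
proof (induction xs arbitrary: x y)
  case (Cons a xs)
  have eqs: "lam r (lam r a x) (lam r (rho r x a) y) = lam r a (lam r x y)"
    "rho r (lam r (rho r x a) y) (lam r a x) = lam r (rho r (lam r x y) a) (rho r y x)"
    "rho r y (rho r x a) = rho r (rho r y x) (rho r (lam r x y) a)"
    using assms by (simp_all add: yang_baxter_components)
  show ?case
    using Cons[of "lam r (rho r x a) y" "lam r a x"] eqs by simp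
qed simp

lemma bij_pull:
  assumes "right_non_degenerate r"
  shows "bij (pull r y)"
proof -
  have rho: "bij (rho r z)" for z using assms by (simp add: right_non_degenerate_def)
  have "xs = ys" if "pull r y xs = pull r y ys" for xs ys
    using that
  proof (induction xs arbitrary: y ys)
    case Nil
    then show ?case by (cases ys) auto
  next
    case (Cons a xs)
    then obtain b zs where ys: "ys = b # zs" by (cases ys) auto
    have "a = b" using Cons.prems ys bij_is_inj[OF rho] by (auto dest: injD)
    then show ?case using Cons ys by auto
  qed
  moreover have "\<exists>xs. pull r y xs = zs" for zs
  proof (induction zs arbitrary: y)
    case (Cons c zs)
    obtain b where b: "rho r y b = c" using bij_is_surj[OF rho] by (metis surj_def)
    obtain xs where "pull r (lam r b y) xs = zs" using Cons by blast
    then have "pull r y (b # xs) = c # zs" using b by simp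
    then show ?case by blast
  qed (intro exI[of _ "[]"], simp)
  ultimately show ?thesis by (metis bijI injI surjI)
qed

function guitar :: "('x \<times> 'x \<Rightarrow> 'x \<times> 'x) \<Rightarrow> ('x \<Rightarrow> 'x) \<Rightarrow> 'x list \<Rightarrow> 'x list" where
  "guitar r k [] = []"
| "guitar r k (c # xs) = c # guitar r k (pull r (k c) xs)"
  by pat_completeness auto
termination by (relation "measure (\<lambda>(r, k, xs). length xs)") auto

lemma length_guitar [simp]: "length (guitar r k xs) = length xs"
  by (induction r k xs rule: guitar.induct) auto

lemma bij_guitar:
  assumes "right_non_degenerate r"
  shows "bij (guitar r k)"
proof -
  note pull = bij_pull[OF assms]
  have "xs = ys" if "guitar r k xs = guitar r k ys" for xs ys
    using that
  proof (induction "length xs" arbitrary: xs ys)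
    case 0
    then show ?case by (cases ys) auto
  next
    case (Suc n)
    obtain a as b bs where "xs = a # as" "ys = b # bs"
      using Suc.hyps(2) Suc.prems by (cases xs; cases ys) auto
    moreover from this have "a = b" "pull r (k a) as = pull r (k a) bs"
      using Suc.hyps(1)[of "pull r (k a) as" "pull r (k a) bs"] Suc.hyps(2) Suc.prems by auto
    ultimately show ?case
      by (simp add: inj_eq[OF bij_is_inj[OF pull]])
  qed
  moreover have "\<exists>xs. guitar r k xs = zs" for zs
  proof (induction zs)
    case (Cons c zs)
    then obtain ys where "guitar r k ys = zs" by blast
    moreover obtain xs where "pull r (k c) xs = ys" using bij_is_surj[OF pull] by (metis surj_def)
    ultimately have "guitar r k (c # xs) = c # zs" by simp
    then show ?case by blast
  qed (intro exI[of _ "[]"], simp)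
  ultimately show ?thesis by (metis bijI injI surjI)
qed

text \<open>
  The argument \<open>\<rho>\<^bsub>k(b)\<^esub>(c)\<close> cancels the inverse in the definition of the derived solution; this is
  the case of two strands of the intertwining property.
\<close>

lemma derived_apply:
  assumes "right_non_degenerate r"
  shows "derived r k (rho r (k b) c, b) = (rho r (k (rho r b c)) (lam r c b), rho r b c)"
proof -
  have "bij (rho r (k b))" using assms by (simp add: right_non_degenerate_def)
  then have "inv_into UNIV (rho r (k b)) (rho r (k b) c) = c" by (simp add: bij_is_inj)
  then show ?thesis by (simp add: derived_def Let_def)
qed

lemma reflection_components:
  assumes "reflection r k"
  shows "lam r (lam r b (k c)) (k (rho r (k c) b)) = lam r (lam r b c) (k (rho r c b))"
    and "rho r (k (rho r (k c) b)) (lam r b (k c)) = k (rho r (k (rho r c b)) (lam r b c))"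
proof -
  have "r (map_prod id k (r (map_prod id k (b, c)))) = map_prod id k (r (map_prod id k (r (b, c))))"
    using assms unfolding reflection_def by (metis comp_apply)
  moreover have "r (x, y) = (lam r x y, rho r y x)" for x y
    by (simp add: lam_def rho_def)
  ultimately show
    "lam r (lam r b (k c)) (k (rho r (k c) b)) = lam r (lam r b c) (k (rho r c b))"
    "rho r (k (rho r (k c) b)) (lam r b (k c)) = k (rho r (k (rho r c b)) (lam r b c))"
    by simp_all
qed

text \<open>
  At the last two strands, the pair of colours pulled across the remaining strands changes by \<open>r\<close>,
  by the reflection equation, and such a change is invisible to the remaining strands. Further to
  the left, the crossing slides through the strand that is pulled out first.
\<close>

lemma guitar_apply_back:
  assumes yb: "yang_baxter r" and rnd: "right_non_degenerate r" and refl: "reflection r k"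
    and "Suc j < length xs"
  shows "guitar r k (apply_back r j xs) = apply_back (derived r k) j (guitar r k xs)"
  using assms(4)
proof (induction j arbitrary: xs)
  case 0
  then obtain c b zs where xs: "xs = c # b # zs"
    by (cases xs; cases "tl xs") auto
  have "pull r (k (rho r (k c) b)) (pull r (lam r b (k c)) zs)
      = pull r (k (rho r (k (rho r c b)) (lam r b c)))
          (pull r (lam r (lam r b c) (k (rho r c b))) zs)"
    using pull_pull[OF yb] reflection_components[OF refl, where b = b and c = c] by metis
  then show ?case
    using derived_apply[OF rnd, of k c b] by (simp add: xs lam_def[of "derived r k"] rho_def[of "derived r k"])
next
  case (Suc j)
  then show ?case by (cases xs) (auto simp: pull_apply_back[OF yb])
qed

lemma bij_betw_guitar_tuples:
  assumes "right_non_degenerate r"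
  shows "bij_betw (\<lambda>xs. rev (guitar r k (rev xs))) (tuples n) (tuples n)"
proof -
  have rev: "bij (rev :: 'a list \<Rightarrow> 'a list)" by (rule involuntory_imp_bij) simp
  have bij: "bij (\<lambda>xs. rev (guitar r k (rev xs)))"
    using bij_comp[OF bij_comp[OF rev bij_guitar[OF assms, of k]] rev]
    by (simp add: comp_def)
  have "(\<lambda>xs. rev (guitar r k (rev xs))) ` tuples n = tuples n" (is "?J ` _ = _")
  proof
    show "tuples n \<subseteq> ?J ` tuples n"
    proof
      fix ys :: "'a list" assume "ys \<in> tuples n"
      moreover obtain xs where "ys = ?J xs" using surjD[OF bij_is_surj[OF bij]] by blast
      ultimately show "ys \<in> ?J ` tuples n" by (intro image_eqI[of _ _ xs]) (auto simp: tuples_def)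
    qed
  qed (auto simp: tuples_def)
  then show ?thesis using bij_is_inj[OF bij] by (auto simp: bij_betw_def intro: inj_on_subset)
qed

lemma guitar_at_pos:
  assumes "yang_baxter r" and "right_non_degenerate r" and "reflection r k"
    and "1 \<le> i" and "i < n" and "xs \<in> tuples n"
  shows "rev (guitar r k (rev (at_pos r i xs)))
       = at_pos (derived r k) i (rev (guitar r k (rev xs)))"
proof -
  have len: "length xs = n" using assms by (simp add: tuples_def)
  have "rev (guitar r k (rev xs)) \<in> tuples n" using len by (simp add: tuples_def)
  moreover have "Suc (n - 1 - i) < length (rev xs)" using len assms by simp
  ultimately show ?thesis
    using assms by (simp add: at_pos_eq_apply_back guitar_apply_back)
qed

section \<open>Transfer to the derived solution\<close>

lemma right_non_degenerate_derived:
  assumes "right_non_degenerate r"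
  shows "right_non_degenerate (derived r k)"
proof -
  have "rho (derived r k) b = rho r b \<circ> inv_into UNIV (rho r (k b))" for b
    by (simp add: fun_eq_iff rho_def derived_def Let_def)
  then show ?thesis
    using assms unfolding right_non_degenerate_def by (auto intro: bij_comp bij_imp_bij_inv)
qed

lemma yang_baxter_derived:
  assumes "yang_baxter r" and "right_non_degenerate r" and "reflection r k"
  shows "yang_baxter (derived r k)"
  unfolding yang_baxter_def
proof
  fix ys :: "'a list" assume "ys \<in> tuples 3"
  then obtain xs where xs: "xs \<in> tuples 3" "ys = rev (guitar r k (rev xs))"
    using bij_betw_guitar_tuples[OF assms(2), of k 3] by (auto simp: bij_betw_def)
  have J: "at_pos (derived r k) i (rev (guitar r k (rev zs))) = rev (guitar r k (rev (at_pos r i zs)))"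
    if "i = 1 \<or> i = 2" "zs \<in> tuples 3" for i zs
    using guitar_at_pos[OF assms, of i 3 zs] that by auto
  show "(at_pos (derived r k) 1 \<circ> at_pos (derived r k) 2 \<circ> at_pos (derived r k) 1) ys
      = (at_pos (derived r k) 2 \<circ> at_pos (derived r k) 1 \<circ> at_pos (derived r k) 2) ys"
    using assms(1) xs by (simp add: J at_pos_tuples yang_baxter_def)
qed

text \<open>The guitar map on pairs, which conjugates \<open>r\<close> itself to the derived solution.\<close>

definition guitar2 :: "('x \<times> 'x \<Rightarrow> 'x \<times> 'x) \<Rightarrow> ('x \<Rightarrow> 'x) \<Rightarrow> 'x \<times> 'x \<Rightarrow> 'x \<times> 'x" where
  "guitar2 r k = (\<lambda>(c, b). (rho r (k b) c, b))"

lemma bij_guitar2: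
  assumes "right_non_degenerate r"
  shows "bij (guitar2 r k)"
proof -
  have rho: "bij (rho r z)" for z using assms by (simp add: right_non_degenerate_def)
  show ?thesis
    by (rule o_bij[of "\<lambda>(a, b). (inv_into UNIV (rho r (k b)) a, b)"])
      (use rho in \<open>auto simp: guitar2_def fun_eq_iff bij_is_inj bij_is_surj surj_f_inv_f\<close>)
qed

lemma derived_guitar2:
  assumes "right_non_degenerate r"
  shows "derived r k \<circ> guitar2 r k = guitar2 r k \<circ> r"
proof (rule ext, clarify)
  fix c b
  have "r (c, b) = (lam r c b, rho r b c)" by (simp add: lam_def rho_def)
  then show "(derived r k \<circ> guitar2 r k) (c, b) = (guitar2 r k \<circ> r) (c, b)"
    using derived_apply[OF assms, of k b c] by (simp add: guitar2_def)
qed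

lemma conjugate_funpow:
  assumes "g \<circ> J = J \<circ> f"
  shows "(g ^^ n) \<circ> J = J \<circ> (f ^^ n)"
proof -
  have "g (J x) = J (f x)" for x using fun_cong[OF assms, of x] by simp
  then have "(g ^^ n) (J x) = J ((f ^^ n) x)" for x by (induction n) simp_all
  then show ?thesis by (simp add: fun_eq_iff)
qed

lemma conjugate_funpow_eq_iff:
  assumes "bij J" and "g \<circ> J = J \<circ> f"
  shows "f ^^ s = f ^^ t \<longleftrightarrow> g ^^ s = g ^^ t"
proof -
  have "f ^^ s = f ^^ t \<longleftrightarrow> J \<circ> (f ^^ s) = J \<circ> (f ^^ t)"
    using bij_is_inj[OF assms(1)] by (auto simp: fun_eq_iff inj_eq)
  also have "\<dots> \<longleftrightarrow> (g ^^ s) \<circ> J = (g ^^ t) \<circ> J"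
    by (simp add: conjugate_funpow[OF assms(2)])
  also have "\<dots> \<longleftrightarrow> g ^^ s = g ^^ t"
    using bij_is_surj[OF assms(1)] by (metis (no_types) comp_assoc comp_id surj_iff)
  finally show ?thesis .
qed

lemma conjugate_bij_iff:
  assumes "bij J" and "g \<circ> J = J \<circ> f"
  shows "bij f \<longleftrightarrow> bij g"
proof -
  have "bij f \<longleftrightarrow> bij (J \<circ> f)"
    using assms(1) by (metis bij_betw_comp_iff2 bij_comp subset_UNIV)
  also have "\<dots> \<longleftrightarrow> bij (g \<circ> J)" by (simp add: assms(2))
  also have "\<dots> \<longleftrightarrow> bij g" using assms(1) by (metis bij_betw_comp_iff)
  finally show ?thesis .
qed

theorem corollary1p9:
  fixes r :: "'x \<times> 'x \<Rightarrow> 'x \<times> 'x" and k :: "'x \<Rightarrow> 'x"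
  assumes "yang_baxter r" and "right_non_degenerate r" and "reflection r k"
  shows "(yang_baxter (derived r k) \<and> right_non_degenerate (derived r k)) \<and>
    (\<forall>n. monoid_action (braid_monoid n) (tuples n) (braid_monoid_act n r) \<and>
         monoid_action (braid_monoid n) (tuples n) (braid_monoid_act n (derived r k)) \<and>
         isomorphic_actions (braid_monoid n) (tuples n) (braid_monoid_act n r)
           (tuples n) (braid_monoid_act n (derived r k))) \<and>
    (bij r \<longrightarrow>
      (\<forall>n. group_action (braid_group n) (tuples n) (braid_group_act n r) \<and>
           group_action (braid_group n) (tuples n) (braid_group_act n (derived r k)) \<and>
           isomorphic_actions (braid_group n) (tuples n) (braid_group_act n r)
             (tuples n) (braid_group_act n (derived r k)))) \<and>
    (\<forall>s t :: nat. s > t \<longrightarrow> (r ^^ s = r ^^ t \<longleftrightarrow> derived r k ^^ s = derived r k ^^ t)) \<and>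
    (involutive_map r \<longleftrightarrow> involutive_map (derived r k)) \<and>
    (idempotent_map r \<longleftrightarrow> idempotent_map (derived r k)) \<and>
    (bij r \<longleftrightarrow> bij (derived r k))"
proof -
  let ?J = "\<lambda>xs. rev (guitar r k (rev xs))"
  note conj = bij_guitar2[OF assms(2), of k] derived_guitar2[OF assms(2), of k]
  note yb = assms(1) yang_baxter_derived[OF assms]
  note J = bij_betw_guitar_tuples[OF assms(2), of k] guitar_at_pos[OF assms]
  have pow: "r ^^ s = r ^^ t \<longleftrightarrow> derived r k ^^ s = derived r k ^^ t" for s t
    by (rule conjugate_funpow_eq_iff[OF conj])
  have bij: "bij r \<longleftrightarrow> bij (derived r k)"
    by (rule conjugate_bij_iff[OF conj])
  have "isomorphic_actions (braid_monoid n) (tuples n) (braid_monoid_act n r)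
      (tuples n) (braid_monoid_act n (derived r k))" for n
    by (rule isomorphic_braid_monoid_actions[OF yb J])
  moreover have "isomorphic_actions (braid_group n) (tuples n) (braid_group_act n r)
      (tuples n) (braid_group_act n (derived r k))" if "bij r" for n
    using that bij by (intro isomorphic_braid_group_actions[OF yb _ _ J]) simp_all
  moreover have "involutive_map r \<longleftrightarrow> involutive_map (derived r k)"
    using pow[of 2 0] by (simp add: involutive_map_def id_def)
  moreover have "idempotent_map r \<longleftrightarrow> idempotent_map (derived r k)"
    using pow[of 2 1] by (simp add: idempotent_map_def)
  ultimately show ?thesis
    using right_non_degenerate_derived[OF assms(2)] yb pow bij
      monoid_action_braid_monoid group_action_braid_group by blast
qed

end
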